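(* Let $\mathcal{L}$ be a classical propositional language. (I) Let $\mathrel{|\!\sim}$ be a logic satisfying (LLE) and (CCL), and define $f:\boldsymbol{D}_{\mathcal{L}}\to\boldsymbol{D}_{\mathcal{L}}$ by $f(M(T)):=M(\overline{\overline{T}})$. Then $f$ is well defined, satisfies $(\mu dp)$, and $\overline{\overline{T}}=Th(f(M(T)))$ for every theory $T$. Moreover, in each row below marked "$\Rightarrow$", if $\mathrel{|\!\sim}$ satisfies the logical rule (and $f$ satisfies the additional properties indicated), then $f$ satisfies the algebraic condition. (II) Conversely, let $f:\mathcal{Y}\to\mathcal{P}(M_{\mathcal{L}})$ with $\boldsymbol{D}_{\mathcal{L}}\subseteq\mathcal{Y}$, and define a logic $\mathrel{|\!\sim}$ by $\overline{\overline{T}}:=Th(f(M(T)))$. Then $\mathrel{|\!\sim}$ satisfies (LLE) and (CCL). If $f$ satisfies $(\mu dp)$, then $f(M(T))=M(\overline{\overline{T}})$ for all $T$. Moreover, in each row below marked "$\Leftarrow$", if $f$ satisfies the algebraic condition (and the additional properties indicated), then $\mathrel{|\!\sim}$ satisfies the logical rule. Where it says "$T$ a formula" (or "$T'$ a formula"), the rule is asserted for all instances in which the theory called $T$ (resp. $T'$) in the rule is classically equivalent to a single formula. "$\not\Leftarrow$ without $(\mu dp)$" means that $(\mu dp)$ cannot be dropped in the implication "$\Leftarrow$" stated just before: there are $\mathcal{L}$ and $f$ as in (II) satisfying the algebraic condition and the other additional properties indicated there, but not $(\mu dp)$, such that the resulting logic violates the logical rule. Basics: (1) $(OR)$ vs.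 $(\mu OR)$: (1.1) $\Rightarrow$; (1.2) $\Leftarrow$. (2) $(disjOR)$ vs. $(\mu disjOR)$: (2.1) $\Rightarrow$; (2.2) $\Leftarrow$. (3) $(wOR)$ vs. $(\mu wOR)$: (3.1) $\Rightarrow$; (3.2) $\Leftarrow$. (4) $(SC)$ vs. $(\mu\subseteq)$: (4.1) $\Rightarrow$; (4.2) $\Leftarrow$. (5) $(CP)$ vs. $(\mu\emptyset)$: (5.1) $\Rightarrow$; (5.2) $\Leftarrow$. (6) $(PR)$ vs. $(\mu PR)$: (6.1) $\Rightarrow$; (6.2) $\Leftarrow$ with $(\mu dp)$ and $(\mu\subseteq)$; (6.3) $\not\Leftarrow$ without $(\mu dp)$; (6.4) $\Leftarrow$ with $(\mu\subseteq)$ and $T'$ a formula. (6.5) $(PR)$ vs. $(\mu PR')$: $\Leftarrow$ with $T'$ a formula. (7) $(CUT)$ vs. $(\mu CUT)$: (7.1) $\Rightarrow$; (7.2) $\Leftarrow$. Cumulativity: (8) $(CM)$ vs. $(\mu CM)$: (8.1) $\Rightarrow$; (8.2) $\Leftarrow$. (9) $(ResM)$ vs. $(\mu ResM)$: (9.1) $\Rightarrow$; (9.2) $\Leftarrow$. (10) $(\subseteq\supseteq)$ vs. $(\mu\subseteq\supseteq)$: (10.1) $\Rightarrow$; (10.2) $\Leftarrow$. (11) $(CUM)$ vs. $(\mu CUM)$: (11.1) $\Rightarrow$; (11.2) $\Leftarrow$. Rationality: (12) $(RatM)$ vs. $(\mu RatM)$: (12.1) $\Rightarrow$; (12.2) $\Leftarrow$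 with $(\mu dp)$; (12.3) $\not\Leftarrow$ without $(\mu dp)$; (12.4) $\Leftarrow$ with $T$ a formula. (13) $(RatM=)$ vs. $(\mu=)$: (13.1) $\Rightarrow$; (13.2) $\Leftarrow$ with $(\mu dp)$; (13.3) $\not\Leftarrow$ without $(\mu dp)$; (13.4) $\Leftarrow$ with $T$ a formula. (14) $(Log=')$ vs. $(\mu=')$: (14.1) $\Rightarrow$; (14.2) $\Leftarrow$ with $(\mu dp)$; (14.3) $\not\Leftarrow$ without $(\mu dp)$; (14.4) $\Leftarrow$ with $T$ a formula. (15) $(Log\parallel)$ vs. $(\mu\parallel)$: (15.1) $\Rightarrow$; (15.2) $\Leftarrow$. (16) $(Log\cup)$ vs. $(\mu\cup)$: (16.1) $\Rightarrow$ with $(\mu\subseteq)$ and $(\mu=)$; (16.2) $\Leftarrow$ with $(\mu dp)$; (16.3) $\not\Leftarrow$ without $(\mu dp)$. (17) $(Log\cup')$ vs. $(\mu\cup')$: (17.1) $\Rightarrow$ with $(\mu\subseteq)$ and $(\mu=)$; (17.2) $\Leftarrow$ with $(\mu dp)$; (17.3) $\not\Leftarrow$ without $(\mu dp)$.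
   Context: A theory is an arbitrary set of formulas of $\mathcal{L}$; $\vdash$ is classical consequence; $\overline{T}=\{\phi:T\vdash\phi\}$. $M_{\mathcal{L}}$ is the set of classical models of $\mathcal{L}$, $M(T)$ the set of models of $T$, $\boldsymbol{D}_{\mathcal{L}}=\{M(T):T\text{ a theory}\}$. For $X\subseteq M_{\mathcal{L}}$, $Th(X)=\{\phi:X\models\phi\}$. $Con(\cdot)$ means classical consistency. $T\vee T':=\{\phi\vee\phi':\phi\in T,\phi'\in T'\}$. A logic $\mathrel{|\!\sim}$ is a relation between theories and formulas; $\overline{\overline{T}}:=\{\phi:T\mathrel{|\!\sim}\phi\}$. $(\mu dp)$ for $f$: $f(X)\in\boldsymbol{D}_{\mathcal{L}}$ for every $X\in\boldsymbol{D}_{\mathcal{L}}$ in the domain of $f$. Logical rules (for all theories $T,T'$): (LLE): $\overline{T}=\overline{T'}\Rightarrow\overline{\overline{T}}=\overline{\overline{T'}}$. (CCL): $\overline{\overline{T}}$ is classically closed. $(OR)$: $\overline{\overline{T}}\cap\overline{\overline{T'}}\subseteq\overline{\overline{T\vee T'}}$. $(disjOR)$: $\neg Con(T\cup T')\Rightarrow\overline{\overline{T}}\cap\overline{\overline{T'}}\subseteq\overline{\overline{T\vee T'}}$. $(wOR)$: $\overline{\overline{T}}\cap\overline{T'}\subseteq\overline{\overline{T\vee T'}}$. $(SC)$: $\overline{T}\subseteq\overline{\overline{T}}$. $(CP)$: $T\mathrel{|\!\sim}\bot\Rightarrow T\vdash\bot$. $(PR)$: $\overline{\overline{T\cup T'}}\subseteq\overline{\overline{\overline{T}}\cup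 T'}$ (right side: classical closure of $\overline{\overline{T}}\cup T'$). $(CUT)$: $T\subseteq\overline{T'}\subseteq\overline{\overline{T}}\Rightarrow\overline{\overline{T'}}\subseteq\overline{\overline{T}}$. $(CM)$: $T\subseteq\overline{T'}\subseteq\overline{\overline{T}}\Rightarrow\overline{\overline{T}}\subseteq\overline{\overline{T'}}$. $(ResM)$: for every theory $\Delta$ and formulas $\alpha,\beta$: $\Delta\mathrel{|\!\sim}\alpha$ and $\Delta\mathrel{|\!\sim}\beta$ imply $\Delta\cup\{\alpha\}\mathrel{|\!\sim}\beta$. $(CUM)$: $T\subseteq\overline{T'}\subseteq\overline{\overline{T}}\Rightarrow\overline{\overline{T}}=\overline{\overline{T'}}$. $(\subseteq\supseteq)$: $T\subseteq\overline{\overline{T'}}$, $T'\subseteq\overline{\overline{T}}\Rightarrow\overline{\overline{T'}}=\overline{\overline{T}}$. $(RatM)$: $Con(T\cup\overline{\overline{T'}})$, $T\vdash T'\Rightarrow\overline{\overline{T}}\supseteq\overline{\overline{\overline{T'}}\cup T}$ (right side: classical closure of $\overline{\overline{T'}}\cup T$; likewise below). $(RatM=)$: $Con(T\cup\overline{\overline{T'}})$, $T\vdash T'\Rightarrow\overline{\overline{T}}=\overline{\overline{\overline{T'}}\cup T}$. $(Log=')$: $Con(\overline{\overline{T'}}\cup T)\Rightarrow\overline{\overline{T\cup T'}}=\overline{\overline{\overline{T'}}\cup T}$. $(Log\parallel)$: $\overline{\overline{T\vee T'}}$ is one of $\overline{\overline{T}}$, $\overline{\overline{T'}}$, $\overline{\overline{T}}\cap\overline{\overline{T'}}$.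 $(Log\cup)$: $Con(\overline{\overline{T'}}\cup T)$, $\neg Con(\overline{\overline{T'}}\cup\overline{\overline{T}})\Rightarrow\neg Con(\overline{\overline{T\vee T'}}\cup T')$. $(Log\cup')$: $Con(\overline{\overline{T'}}\cup T)$, $\neg Con(\overline{\overline{T'}}\cup\overline{\overline{T}})\Rightarrow\overline{\overline{T\vee T'}}=\overline{\overline{T}}$. Algebraic conditions (for all $X,Y$ in the domain of $f$, whenever all sets to which $f$ is applied lie in the domain): $(\mu OR)$: $f(X\cup Y)\subseteq f(X)\cup f(Y)$. $(\mu disjOR)$: $X\cap Y=\emptyset\Rightarrow f(X\cup Y)\subseteq f(X)\cup f(Y)$. $(\mu wOR)$: $f(X\cup Y)\subseteq f(X)\cup Y$. $(\mu\subseteq)$: $f(X)\subseteq X$. $(\mu\emptyset)$: $f(X)=\emptyset\Rightarrow X=\emptyset$. $(\mu PR)$: $X\subseteq Y\Rightarrow f(Y)\cap X\subseteq f(X)$. $(\mu PR')$: $f(X)\cap Y\subseteq f(X\cap Y)$. $(\mu CUT)$: $f(X)\subseteq Y\subseteq X\Rightarrow f(X)\subseteq f(Y)$. $(\mu CM)$: $f(X)\subseteq Y\subseteq X\Rightarrow f(Y)\subseteq f(X)$. $(\mu ResM)$: $f(X)\subseteq A\cap B\Rightarrow f(X\cap A)\subseteq B$, where here $A=M(\alpha)$, $B=M(\beta)$ range over model sets of single formulas and $X$ over $\boldsymbol{D}_{\mathcal{L}}$. $(\mu CUM)$: $f(X)\subseteq Y\subseteq X\Rightarrow f(Y)=f(X)$.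 $(\mu\subseteq\supseteq)$: $f(X)\subseteq Y$, $f(Y)\subseteq X\Rightarrow f(X)=f(Y)$. $(\mu RatM)$: $X\subseteq Y$, $X\cap f(Y)\neq\emptyset\Rightarrow f(X)\subseteq f(Y)\cap X$. $(\mu=)$: $X\subseteq Y$, $X\cap f(Y)\neq\emptyset\Rightarrow f(X)=f(Y)\cap X$. $(\mu=')$: $f(Y)\cap X\neq\emptyset\Rightarrow f(Y\cap X)=f(Y)\cap X$. $(\mu\parallel)$: $f(X\cup Y)$ is one of $f(X)$, $f(Y)$, $f(X)\cup f(Y)$. $(\mu\cup)$: $f(Y)\cap(X-f(X))\neq\emptyset\Rightarrow f(X\cup Y)\cap Y=\emptyset$. $(\mu\cup')$: $f(Y)\cap(X-f(X))\neq\emptyset\Rightarrow f(X\cup Y)=f(X)$. *)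

theory Defs
  imports Main "HOL-Library.FuncSet"
begin

datatype (atoms: 'v) fm =
    Atom 'v
  | Bot
  | Neg "'v fm"
  | Conj "'v fm" "'v fm"
  | Disj "'v fm" "'v fm"
  | Impl "'v fm" "'v fm"

primrec sat :: "'v set \<Rightarrow> 'v fm \<Rightarrow> bool" where
  "sat m (Atom p) = (p \<in> m)"
| "sat m Bot = False"
| "sat m (Neg \<phi>) = (\<not> sat m \<phi>)"
| "sat m (Conj \<phi> \<psi>) = (sat m \<phi> \<and> sat m \<psi>)"
| "sat m (Disj \<phi> \<psi>) = (sat m \<phi> \<or> sat m \<psi>)"
| "sat m (Impl \<phi> \<psi>) = (sat m \<phi> \<longrightarrow> sat m \<psi>)"

text \<open>
  A propositional language is given by an arbitrary (finite or infinite) set \<open>V\<close> of propositional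
  variables.  A classical model is represented by the set of variables that it makes true.
  A theory is any subset of \<open>lang V\<close>.
\<close>

definition lang :: "'v set \<Rightarrow> 'v fm set" where
  "lang V = {\<phi>. atoms \<phi> \<subseteq> V}"

definition models :: "'v set \<Rightarrow> 'v set set" where
  "models V = Pow V"

definition Mod :: "'v set \<Rightarrow> 'v fm set \<Rightarrow> 'v set set" where
  "Mod V T = {m \<in> models V. \<forall>\<phi>\<in>T. sat m \<phi>}"

definition DL :: "'v set \<Rightarrow> 'v set set set" where
  "DL V = {Mod V T | T. T \<subseteq> lang V}"

definition Th :: "'v set \<Rightarrow> 'v set set \<Rightarrow> 'v fm set" where
  "Th V X = {\<phi> \<in> lang V. \<forall>m\<in>X. sat m \<phi>}"

definition entails :: "'v set \<Rightarrow> 'v fm set \<Rightarrow> 'v fm \<Rightarrow> bool" where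
  "entails V T \<phi> \<longleftrightarrow> (\<forall>m\<in>Mod V T. sat m \<phi>)"

definition Cn :: "'v set \<Rightarrow> 'v fm set \<Rightarrow> 'v fm set" where
  "Cn V T = {\<phi> \<in> lang V. entails V T \<phi>}"

definition Con :: "'v set \<Rightarrow> 'v fm set \<Rightarrow> bool" where
  "Con V T \<longleftrightarrow> \<not> entails V T Bot"

definition or_theory :: "'v fm set \<Rightarrow> 'v fm set \<Rightarrow> 'v fm set" (infixl "\<or>\<^sub>T" 65) where
  "T \<or>\<^sub>T T' = {Disj \<phi> \<psi> | \<phi> \<psi>. \<phi> \<in> T \<and> \<psi> \<in> T'}"

definition is_formula :: "'v set \<Rightarrow> 'v fm set \<Rightarrow> bool" where
  "is_formula V T \<longleftrightarrow> (\<exists>\<phi>\<in>lang V. Cn V T = Cn V {\<phi>})"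


text \<open>
  A logic for \<open>V\<close> is a relation between theories and formulas; only its values on subsets of
  \<open>lang V\<close> and elements of \<open>lang V\<close> are ever used.  The set \<open>ncl V nm T\<close> is the double-overlined
  \<open>T\<close>, and \<open>Cn V T\<close> the single-overlined one.
\<close>

type_synonym 'v logic = "'v fm set \<Rightarrow> 'v fm \<Rightarrow> bool"

definition ncl :: "'v set \<Rightarrow> 'v logic \<Rightarrow> 'v fm set \<Rightarrow> 'v fm set" where
  "ncl V nm T = {\<phi> \<in> lang V. nm T \<phi>}"

definition LLE :: "'v set \<Rightarrow> 'v logic \<Rightarrow> bool" where
  "LLE V nm \<longleftrightarrow> (\<forall>T T'. T \<subseteq> lang V \<longrightarrow> T' \<subseteq> lang V \<longrightarrow>
     Cn V T = Cn V T' \<longrightarrow> ncl V nm T = ncl V nm T')"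

definition CCL :: "'v set \<Rightarrow> 'v logic \<Rightarrow> bool" where
  "CCL V nm \<longleftrightarrow> (\<forall>T. T \<subseteq> lang V \<longrightarrow> Cn V (ncl V nm T) = ncl V nm T)"

definition OR :: "'v set \<Rightarrow> 'v logic \<Rightarrow> bool" where
  "OR V nm \<longleftrightarrow> (\<forall>T T'. T \<subseteq> lang V \<longrightarrow> T' \<subseteq> lang V \<longrightarrow>
     ncl V nm T \<inter> ncl V nm T' \<subseteq> ncl V nm (T \<or>\<^sub>T T'))"

definition disjOR :: "'v set \<Rightarrow> 'v logic \<Rightarrow> bool" where
  "disjOR V nm \<longleftrightarrow> (\<forall>T T'. T \<subseteq> lang V \<longrightarrow> T' \<subseteq> lang V \<longrightarrow>
     \<not> Con V (T \<union> T') \<longrightarrow> ncl V nm T \<inter> ncl V nm T' \<subseteq> ncl V nm (T \<or>\<^sub>T T'))"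

definition wOR :: "'v set \<Rightarrow> 'v logic \<Rightarrow> bool" where
  "wOR V nm \<longleftrightarrow> (\<forall>T T'. T \<subseteq> lang V \<longrightarrow> T' \<subseteq> lang V \<longrightarrow>
     ncl V nm T \<inter> Cn V T' \<subseteq> ncl V nm (T \<or>\<^sub>T T'))"

definition SC :: "'v set \<Rightarrow> 'v logic \<Rightarrow> bool" where
  "SC V nm \<longleftrightarrow> (\<forall>T. T \<subseteq> lang V \<longrightarrow> Cn V T \<subseteq> ncl V nm T)"

definition CP :: "'v set \<Rightarrow> 'v logic \<Rightarrow> bool" where
  "CP V nm \<longleftrightarrow> (\<forall>T. T \<subseteq> lang V \<longrightarrow> nm T Bot \<longrightarrow> entails V T Bot)"

definition CUT :: "'v set \<Rightarrow> 'v logic \<Rightarrow> bool" where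
  "CUT V nm \<longleftrightarrow> (\<forall>T T'. T \<subseteq> lang V \<longrightarrow> T' \<subseteq> lang V \<longrightarrow>
     T \<subseteq> Cn V T' \<longrightarrow> Cn V T' \<subseteq> ncl V nm T \<longrightarrow> ncl V nm T' \<subseteq> ncl V nm T)"

definition CM :: "'v set \<Rightarrow> 'v logic \<Rightarrow> bool" where
  "CM V nm \<longleftrightarrow> (\<forall>T T'. T \<subseteq> lang V \<longrightarrow> T' \<subseteq> lang V \<longrightarrow>
     T \<subseteq> Cn V T' \<longrightarrow> Cn V T' \<subseteq> ncl V nm T \<longrightarrow> ncl V nm T \<subseteq> ncl V nm T')"

definition ResM :: "'v set \<Rightarrow> 'v logic \<Rightarrow> bool" where
  "ResM V nm \<longleftrightarrow> (\<forall>\<Delta> \<alpha> \<beta>. \<Delta> \<subseteq> lang V \<longrightarrow> \<alpha> \<in> lang V \<longrightarrow> \<beta> \<in> lang V \<longrightarrow>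
     nm \<Delta> \<alpha> \<longrightarrow> nm \<Delta> \<beta> \<longrightarrow> nm (\<Delta> \<union> {\<alpha>}) \<beta>)"

definition CUM :: "'v set \<Rightarrow> 'v logic \<Rightarrow> bool" where
  "CUM V nm \<longleftrightarrow> (\<forall>T T'. T \<subseteq> lang V \<longrightarrow> T' \<subseteq> lang V \<longrightarrow>
     T \<subseteq> Cn V T' \<longrightarrow> Cn V T' \<subseteq> ncl V nm T \<longrightarrow> ncl V nm T = ncl V nm T')"

definition SubSup :: "'v set \<Rightarrow> 'v logic \<Rightarrow> bool" where
  "SubSup V nm \<longleftrightarrow> (\<forall>T T'. T \<subseteq> lang V \<longrightarrow> T' \<subseteq> lang V \<longrightarrow>
     T \<subseteq> ncl V nm T' \<longrightarrow> T' \<subseteq> ncl V nm T \<longrightarrow> ncl V nm T' = ncl V nm T)"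

definition LogPar :: "'v set \<Rightarrow> 'v logic \<Rightarrow> bool" where
  "LogPar V nm \<longleftrightarrow> (\<forall>T T'. T \<subseteq> lang V \<longrightarrow> T' \<subseteq> lang V \<longrightarrow>
     ncl V nm (T \<or>\<^sub>T T') = ncl V nm T \<or>
     ncl V nm (T \<or>\<^sub>T T') = ncl V nm T' \<or>
     ncl V nm (T \<or>\<^sub>T T') = ncl V nm T \<inter> ncl V nm T')"

definition LogCup :: "'v set \<Rightarrow> 'v logic \<Rightarrow> bool" where
  "LogCup V nm \<longleftrightarrow> (\<forall>T T'. T \<subseteq> lang V \<longrightarrow> T' \<subseteq> lang V \<longrightarrow>
     Con V (ncl V nm T' \<union> T) \<longrightarrow> \<not> Con V (ncl V nm T' \<union> ncl V nm T) \<longrightarrow>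
     \<not> Con V (ncl V nm (T \<or>\<^sub>T T') \<union> T'))"

definition LogCup' :: "'v set \<Rightarrow> 'v logic \<Rightarrow> bool" where
  "LogCup' V nm \<longleftrightarrow> (\<forall>T T'. T \<subseteq> lang V \<longrightarrow> T' \<subseteq> lang V \<longrightarrow>
     Con V (ncl V nm T' \<union> T) \<longrightarrow> \<not> Con V (ncl V nm T' \<union> ncl V nm T) \<longrightarrow>
     ncl V nm (T \<or>\<^sub>T T') = ncl V nm T)"

text \<open>
  The remaining four rules are also asserted for restricted classes of instances, so a single
  instance (\<open>_at\<close>) gets its own name.
\<close>

definition PR_at :: "'v set \<Rightarrow> 'v logic \<Rightarrow> 'v fm set \<Rightarrow> 'v fm set \<Rightarrow> bool" where
  "PR_at V nm T T' \<longleftrightarrow> ncl V nm (T \<union> T') \<subseteq> Cn V (ncl V nm T \<union> T')"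

definition PR :: "'v set \<Rightarrow> 'v logic \<Rightarrow> bool" where
  "PR V nm \<longleftrightarrow> (\<forall>T T'. T \<subseteq> lang V \<longrightarrow> T' \<subseteq> lang V \<longrightarrow> PR_at V nm T T')"

definition RatM_at :: "'v set \<Rightarrow> 'v logic \<Rightarrow> 'v fm set \<Rightarrow> 'v fm set \<Rightarrow> bool" where
  "RatM_at V nm T T' \<longleftrightarrow>
     (Con V (T \<union> ncl V nm T') \<longrightarrow> (\<forall>\<phi>\<in>T'. entails V T \<phi>) \<longrightarrow>
      ncl V nm T \<supseteq> Cn V (ncl V nm T' \<union> T))"

definition RatM :: "'v set \<Rightarrow> 'v logic \<Rightarrow> bool" where
  "RatM V nm \<longleftrightarrow> (\<forall>T T'. T \<subseteq> lang V \<longrightarrow> T' \<subseteq> lang V \<longrightarrow> RatM_at V nm T T')"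

definition RatMeq_at :: "'v set \<Rightarrow> 'v logic \<Rightarrow> 'v fm set \<Rightarrow> 'v fm set \<Rightarrow> bool" where
  "RatMeq_at V nm T T' \<longleftrightarrow>
     (Con V (T \<union> ncl V nm T') \<longrightarrow> (\<forall>\<phi>\<in>T'. entails V T \<phi>) \<longrightarrow>
      ncl V nm T = Cn V (ncl V nm T' \<union> T))"

definition RatMeq :: "'v set \<Rightarrow> 'v logic \<Rightarrow> bool" where
  "RatMeq V nm \<longleftrightarrow> (\<forall>T T'. T \<subseteq> lang V \<longrightarrow> T' \<subseteq> lang V \<longrightarrow> RatMeq_at V nm T T')"

definition LogEq'_at :: "'v set \<Rightarrow> 'v logic \<Rightarrow> 'v fm set \<Rightarrow> 'v fm set \<Rightarrow> bool" where
  "LogEq'_at V nm T T' \<longleftrightarrow>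
     (Con V (ncl V nm T' \<union> T) \<longrightarrow> ncl V nm (T \<union> T') = Cn V (ncl V nm T' \<union> T))"

definition LogEq' :: "'v set \<Rightarrow> 'v logic \<Rightarrow> bool" where
  "LogEq' V nm \<longleftrightarrow> (\<forall>T T'. T \<subseteq> lang V \<longrightarrow> T' \<subseteq> lang V \<longrightarrow> LogEq'_at V nm T T')"


text \<open>
  In the algebraic conditions, \<open>D\<close> is the domain of \<open>f\<close>.  It need not be closed under union or
  intersection, so every set to which \<open>f\<close> is applied is required to lie in \<open>D\<close>.
\<close>

type_synonym 'v model_fun = "'v set set \<Rightarrow> 'v set set"

definition mu_dp :: "'v set \<Rightarrow> 'v set set set \<Rightarrow> 'v model_fun \<Rightarrow> bool" where
  "mu_dp V D f \<longleftrightarrow> (\<forall>X\<in>D. X \<in> DL V \<longrightarrow> f X \<in> DL V)"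

definition mu_OR :: "'v set set set \<Rightarrow> 'v model_fun \<Rightarrow> bool" where
  "mu_OR D f \<longleftrightarrow> (\<forall>X\<in>D. \<forall>Y\<in>D. X \<union> Y \<in> D \<longrightarrow> f (X \<union> Y) \<subseteq> f X \<union> f Y)"

definition mu_disjOR :: "'v set set set \<Rightarrow> 'v model_fun \<Rightarrow> bool" where
  "mu_disjOR D f \<longleftrightarrow>
     (\<forall>X\<in>D. \<forall>Y\<in>D. X \<union> Y \<in> D \<longrightarrow> X \<inter> Y = {} \<longrightarrow> f (X \<union> Y) \<subseteq> f X \<union> f Y)"

definition mu_wOR :: "'v set set set \<Rightarrow> 'v model_fun \<Rightarrow> bool" where
  "mu_wOR D f \<longleftrightarrow> (\<forall>X\<in>D. \<forall>Y\<in>D. X \<union> Y \<in> D \<longrightarrow> f (X \<union> Y) \<subseteq> f X \<union> Y)"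

definition mu_sub :: "'v set set set \<Rightarrow> 'v model_fun \<Rightarrow> bool" where
  "mu_sub D f \<longleftrightarrow> (\<forall>X\<in>D. f X \<subseteq> X)"

definition mu_empty :: "'v set set set \<Rightarrow> 'v model_fun \<Rightarrow> bool" where
  "mu_empty D f \<longleftrightarrow> (\<forall>X\<in>D. f X = {} \<longrightarrow> X = {})"

definition mu_PR :: "'v set set set \<Rightarrow> 'v model_fun \<Rightarrow> bool" where
  "mu_PR D f \<longleftrightarrow> (\<forall>X\<in>D. \<forall>Y\<in>D. X \<subseteq> Y \<longrightarrow> f Y \<inter> X \<subseteq> f X)"

definition mu_PR' :: "'v set set set \<Rightarrow> 'v model_fun \<Rightarrow> bool" where
  "mu_PR' D f \<longleftrightarrow> (\<forall>X\<in>D. \<forall>Y\<in>D. X \<inter> Y \<in> D \<longrightarrow> f X \<inter> Y \<subseteq> f (X \<inter> Y))"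

definition mu_CUT :: "'v set set set \<Rightarrow> 'v model_fun \<Rightarrow> bool" where
  "mu_CUT D f \<longleftrightarrow> (\<forall>X\<in>D. \<forall>Y\<in>D. f X \<subseteq> Y \<longrightarrow> Y \<subseteq> X \<longrightarrow> f X \<subseteq> f Y)"

definition mu_CM :: "'v set set set \<Rightarrow> 'v model_fun \<Rightarrow> bool" where
  "mu_CM D f \<longleftrightarrow> (\<forall>X\<in>D. \<forall>Y\<in>D. f X \<subseteq> Y \<longrightarrow> Y \<subseteq> X \<longrightarrow> f Y \<subseteq> f X)"

definition mu_ResM :: "'v set \<Rightarrow> 'v set set set \<Rightarrow> 'v model_fun \<Rightarrow> bool" where
  "mu_ResM V D f \<longleftrightarrow> (\<forall>X\<in>D. \<forall>\<alpha>\<in>lang V. \<forall>\<beta>\<in>lang V.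
     X \<in> DL V \<longrightarrow> X \<inter> Mod V {\<alpha>} \<in> D \<longrightarrow>
     f X \<subseteq> Mod V {\<alpha>} \<inter> Mod V {\<beta>} \<longrightarrow> f (X \<inter> Mod V {\<alpha>}) \<subseteq> Mod V {\<beta>})"

definition mu_CUM :: "'v set set set \<Rightarrow> 'v model_fun \<Rightarrow> bool" where
  "mu_CUM D f \<longleftrightarrow> (\<forall>X\<in>D. \<forall>Y\<in>D. f X \<subseteq> Y \<longrightarrow> Y \<subseteq> X \<longrightarrow> f Y = f X)"

definition mu_SubSup :: "'v set set set \<Rightarrow> 'v model_fun \<Rightarrow> bool" where
  "mu_SubSup D f \<longleftrightarrow> (\<forall>X\<in>D. \<forall>Y\<in>D. f X \<subseteq> Y \<longrightarrow> f Y \<subseteq> X \<longrightarrow> f X = f Y)"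

definition mu_RatM :: "'v set set set \<Rightarrow> 'v model_fun \<Rightarrow> bool" where
  "mu_RatM D f \<longleftrightarrow> (\<forall>X\<in>D. \<forall>Y\<in>D. X \<subseteq> Y \<longrightarrow> X \<inter> f Y \<noteq> {} \<longrightarrow> f X \<subseteq> f Y \<inter> X)"

definition mu_eq :: "'v set set set \<Rightarrow> 'v model_fun \<Rightarrow> bool" where
  "mu_eq D f \<longleftrightarrow> (\<forall>X\<in>D. \<forall>Y\<in>D. X \<subseteq> Y \<longrightarrow> X \<inter> f Y \<noteq> {} \<longrightarrow> f X = f Y \<inter> X)"

definition mu_eq' :: "'v set set set \<Rightarrow> 'v model_fun \<Rightarrow> bool" where
  "mu_eq' D f \<longleftrightarrow>
     (\<forall>X\<in>D. \<forall>Y\<in>D. Y \<inter> X \<in> D \<longrightarrow> f Y \<inter> X \<noteq> {} \<longrightarrow> f (Y \<inter> X) = f Y \<inter> X)"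

definition mu_par :: "'v set set set \<Rightarrow> 'v model_fun \<Rightarrow> bool" where
  "mu_par D f \<longleftrightarrow> (\<forall>X\<in>D. \<forall>Y\<in>D. X \<union> Y \<in> D \<longrightarrow>
     f (X \<union> Y) = f X \<or> f (X \<union> Y) = f Y \<or> f (X \<union> Y) = f X \<union> f Y)"

definition mu_cup :: "'v set set set \<Rightarrow> 'v model_fun \<Rightarrow> bool" where
  "mu_cup D f \<longleftrightarrow> (\<forall>X\<in>D. \<forall>Y\<in>D. X \<union> Y \<in> D \<longrightarrow>
     f Y \<inter> (X - f X) \<noteq> {} \<longrightarrow> f (X \<union> Y) \<inter> Y = {})"

definition mu_cup' :: "'v set set set \<Rightarrow> 'v model_fun \<Rightarrow> bool" where
  "mu_cup' D f \<longleftrightarrow> (\<forall>X\<in>D. \<forall>Y\<in>D. X \<union> Y \<in> D \<longrightarrow>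
     f Y \<inter> (X - f X) \<noteq> {} \<longrightarrow> f (X \<union> Y) = f X)"


text \<open>
  \<open>represents V nm f\<close> is the defining equation of the function on \<open>DL V\<close> obtained from a logic;
  \<open>logic_of V f\<close> is the logic obtained from a function whose domain contains \<open>DL V\<close>.
\<close>

definition represents :: "'v set \<Rightarrow> 'v logic \<Rightarrow> 'v model_fun \<Rightarrow> bool" where
  "represents V nm f \<longleftrightarrow> (\<forall>T. T \<subseteq> lang V \<longrightarrow> f (Mod V T) = Mod V (ncl V nm T))"

definition logic_of :: "'v set \<Rightarrow> 'v model_fun \<Rightarrow> 'v logic" where
  "logic_of V f T \<phi> \<longleftrightarrow> \<phi> \<in> Th V (f (Mod V T))"

definition model_fun_on :: "'v set \<Rightarrow> 'v set set set \<Rightarrow> 'v model_fun \<Rightarrow> bool" where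
  "model_fun_on V D f \<longleftrightarrow> D \<subseteq> Pow (models V) \<and> DL V \<subseteq> D \<and> f \<in> D \<rightarrow> Pow (models V)"

end

theory Submission
  imports Defs
begin

text \<open>
  Call a set of models definable if it is the model set of a theory.  Every set \<open>X\<close> of models has a
  least definable superset, its definable closure \<open>M(Th(X))\<close>.  Since \<open>Th(X)\<close> determines, and is
  determined by, the closure of \<open>X\<close>, an inclusion \<open>Th(X) \<subseteq> Th(Y)\<close> between theories says exactly
  that \<open>Y\<close> lies in the closure of \<open>X\<close>.

  Both parts start from a logic and a function linked by the equation that the consequences of
  \<open>T\<close> form the theory \<open>Th(f(M(T)))\<close>.  This equation alone makes each logical rule
  \<^emph>\<open>equivalent\<close> to a condition on \<open>f\<close> in which definable closures appear (the lemmas with names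
  ending in \<open>_iff\<close> of the locale \<open>generated_logic\<close>); without the closures, this condition is the
  algebraic companion of the rule or close to it.  The dictionary behind this is that union of
  theories becomes intersection of model sets, \<open>T \<or> T'\<close> becomes their union, intersection of
  deductively closed theories becomes union up to closure, and consistency means that the model
  set is nonempty.

  What remains is to say when these closures can be removed.

  \<^item> If \<open>f\<close> maps definable sets to definable sets, all of them disappear, because definable sets are
    closed under finite unions and intersections.  Every \<open>f\<close> that comes from a logic is of this
    kind, and so is every \<open>f\<close> with the property \<open>\<mu>dp\<close>.  Three rules then need a little more:
    \<open>PR\<close> turns into \<open>\<mu>PR'\<close>, which agrees with \<open>\<mu>PR\<close> in the presence of \<open>\<mu>\<subseteq>\<close>; and the two union
    rules ask for \<open>f(X)\<close> and \<open>f(Y)\<close> to be disjoint where their companions only ask for a point of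
    \<open>f(Y)\<close> in \<open>X - f(X)\<close>, which amounts to the same if \<open>\<mu>\<subseteq>\<close> and \<open>\<mu>=\<close> hold.
  \<^item> Without definability, a closure on the larger side of an inclusion, or on both sides of an
    equation, only weakens the condition, so that \<open>Log\<parallel>\<close>, the cumulativity rules and the basic
    rules other than \<open>PR\<close> still follow.
    A closure on the smaller side, as in \<open>closure(f(X)) \<inter> Y \<subseteq> ...\<close>, or inside a consistency
    hypothesis, is harmful in general.  It is harmless if the set \<open>Y\<close> intersected with it is the
    model set of a formula: such a set is definable together with its complement, and therefore
    closure commutes with intersection with \<open>Y\<close>.

  For the counterexamples, take infinitely many variables and let \<open>f\<close> remove one fixed model
  \<open>m\<close> from every set.  A formula mentions finitely many variables and so cannot separate \<open>m\<close> from
  all other models: the closure of \<open>f\<close> of the set of all models contains \<open>m\<close> again.  The algebraic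
  conditions see that \<open>m\<close> is missing, whereas the logic does not, and testing with the definable
  set \<open>{m}\<close>, for which \<open>f({m})\<close> is empty, refutes five of the six rules.  For \<open>RatM\<close> the value
  at \<open>{m}\<close> is changed so that it leaves \<open>{m}\<close>.
\<close>

section \<open>Definable sets and definable closure\<close>

lemma Th_subset_lang: "Th V X \<subseteq> lang V"
  by (auto simp: Th_def)

lemma Mod_subset_models: "Mod V T \<subseteq> models V"
  by (auto simp: Mod_def)

lemma Mod_in_DL: "T \<subseteq> lang V \<Longrightarrow> Mod V T \<in> DL V"
  by (auto simp: DL_def)

lemma DL_subset_models: "X \<in> DL V \<Longrightarrow> X \<subseteq> models V"
  by (auto simp: DL_def Mod_def)

lemma ball_DL_iff: "(\<forall>X\<in>DL V. P X) \<longleftrightarrow> (\<forall>T. T \<subseteq> lang V \<longrightarrow> P (Mod V T))"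
  by (auto simp: DL_def)

lemma subset_Th_iff:
  assumes "T \<subseteq> lang V" "X \<subseteq> models V"
  shows "T \<subseteq> Th V X \<longleftrightarrow> X \<subseteq> Mod V T"
  using assms by (auto simp: Th_def Mod_def)

lemma Cn_eq_Th_Mod: "Cn V T = Th V (Mod V T)"
  by (simp add: Cn_def Th_def entails_def)

lemma Th_Un: "Th V (X \<union> Y) = Th V X \<inter> Th V Y"
  by (auto simp: Th_def)

lemma Mod_Un: "Mod V (T \<union> T') = Mod V T \<inter> Mod V T'"
  by (auto simp: Mod_def)

lemma Mod_or_theory: "Mod V (T \<or>\<^sub>T T') = Mod V T \<union> Mod V T'"
  by (auto simp: Mod_def or_theory_def; fastforce)

lemma or_theory_subset_lang: "T \<subseteq> lang V \<Longrightarrow> T' \<subseteq> lang V \<Longrightarrow> T \<or>\<^sub>T T' \<subseteq> lang V"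
  by (auto simp: or_theory_def lang_def; blast)

lemma Con_iff_Mod: "Con V T \<longleftrightarrow> Mod V T \<noteq> {}"
  by (auto simp: Con_def entails_def)

lemma DL_Un: "X \<in> DL V \<Longrightarrow> Y \<in> DL V \<Longrightarrow> X \<union> Y \<in> DL V"
  unfolding DL_def using Mod_or_theory or_theory_subset_lang by (smt (verit) mem_Collect_eq)

lemma DL_Int: "X \<in> DL V \<Longrightarrow> Y \<in> DL V \<Longrightarrow> X \<inter> Y \<in> DL V"
  unfolding DL_def using Mod_Un by (smt (verit) Un_subset_iff mem_Collect_eq)

text \<open>The least definable superset of \<open>X\<close>, as \<open>subset_dclosure\<close> and \<open>dclosure_minimal\<close> show.\<close>

definition dclosure :: "'v set \<Rightarrow> 'v set set \<Rightarrow> 'v set set" where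
  "dclosure V X = Mod V (Th V X)"

lemma dclosure_in_DL: "dclosure V X \<in> DL V"
  by (simp add: dclosure_def Mod_in_DL Th_subset_lang)

lemma subset_dclosure: "X \<subseteq> models V \<Longrightarrow> X \<subseteq> dclosure V X"
  by (auto simp: dclosure_def Th_def Mod_def)

lemma dclosure_mono: "X \<subseteq> Y \<Longrightarrow> dclosure V X \<subseteq> dclosure V Y"
  by (auto simp: dclosure_def Th_def Mod_def)

lemma dclosure_eq: "X \<in> DL V \<Longrightarrow> dclosure V X = X"
  by (auto simp: dclosure_def Th_def Mod_def DL_def)

lemma dclosure_minimal: "X \<subseteq> Z \<Longrightarrow> Z \<in> DL V \<Longrightarrow> dclosure V X \<subseteq> Z"
  using dclosure_mono dclosure_eq by metis

lemma Th_dclosure: "X \<subseteq> models V \<Longrightarrow> Th V (dclosure V X) = Th V X"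
  by (auto simp: dclosure_def Th_def Mod_def)

text \<open>
  Galois connection between theories and sets of models: comparing theories of sets is comparing
  the sets up to definable closure.  All translations of logical rules rest on this.
\<close>

lemma Th_subset_Th_iff: "X \<subseteq> models V \<Longrightarrow> Th V Z \<subseteq> Th V X \<longleftrightarrow> X \<subseteq> dclosure V Z"
  by (simp add: dclosure_def subset_Th_iff Th_subset_lang)

lemma Th_eq_Th_iff:
  "X \<subseteq> models V \<Longrightarrow> Y \<subseteq> models V \<Longrightarrow> Th V X = Th V Y \<longleftrightarrow> dclosure V X = dclosure V Y"
  by (metis Th_dclosure dclosure_def)

lemma Cn_eq_Cn_iff:
  assumes "T \<subseteq> lang V" "T' \<subseteq> lang V"
  shows "Cn V T = Cn V T' \<longleftrightarrow> Mod V T = Mod V T'"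
  unfolding Cn_eq_Th_Mod
  by (simp add: Th_eq_Th_iff Mod_subset_models dclosure_eq Mod_in_DL assms)

text \<open>
  By the deduction theorem: what follows from \<open>\<phi>\<close> over \<open>X\<close> is an implication with premise \<open>\<phi>\<close> valid
  in \<open>X\<close>, hence in its closure.  For an infinite theory in place of \<open>\<phi>\<close> there need not be such an
  implication, and the equation can fail.
\<close>

lemma dclosure_Int_Mod_formula:
  assumes "\<phi> \<in> lang V" "X \<subseteq> models V"
  shows "dclosure V X \<inter> Mod V {\<phi>} = dclosure V (X \<inter> Mod V {\<phi>})"
proof
  show "dclosure V (X \<inter> Mod V {\<phi>}) \<subseteq> dclosure V X \<inter> Mod V {\<phi>}"
    using assms by (simp add: dclosure_minimal DL_Int dclosure_in_DL Mod_in_DL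
        subset_dclosure le_infI1)
next
  show "dclosure V X \<inter> Mod V {\<phi>} \<subseteq> dclosure V (X \<inter> Mod V {\<phi>})"
  proof
    fix m
    assume m: "m \<in> dclosure V X \<inter> Mod V {\<phi>}"
    have "sat m \<psi>" if "\<psi> \<in> Th V (X \<inter> Mod V {\<phi>})" for \<psi>
    proof -
      have "Impl \<phi> \<psi> \<in> Th V X"
        using that assms by (auto simp: Th_def Mod_def lang_def)
      then show ?thesis
        using m by (auto simp: dclosure_def Mod_def)
    qed
    then show "m \<in> dclosure V (X \<inter> Mod V {\<phi>})"
      using m by (simp add: dclosure_def Mod_def)
  qed
qed

lemma dclosure_empty: "dclosure V {} = {}"
proof -
  have "Bot \<in> Th V {}"
    by (simp add: Th_def lang_def)
  then show ?thesis
    by (force simp: dclosure_def Mod_def)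
qed

lemma dclosure_Int_formula_theory:
  assumes "is_formula V T" "T \<subseteq> lang V" "X \<subseteq> models V"
  shows "dclosure V X \<inter> Mod V T = dclosure V (X \<inter> Mod V T)"
proof -
  obtain \<phi> where "\<phi> \<in> lang V" "Cn V T = Cn V {\<phi>}"
    using assms(1) by (auto simp: is_formula_def)
  moreover from this have "Mod V T = Mod V {\<phi>}"
    using assms(2) by (simp add: Cn_eq_Cn_iff)
  ultimately show ?thesis
    using assms(3) by (simp add: dclosure_Int_Mod_formula)
qed

lemma dclosure_Int_formula_theory_empty_iff:
  assumes "is_formula V T" "T \<subseteq> lang V" "X \<subseteq> models V"
  shows "dclosure V X \<inter> Mod V T = {} \<longleftrightarrow> X \<inter> Mod V T = {}"
  using dclosure_Int_formula_theory[OF assms] dclosure_empty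
  by (metis subset_dclosure le_infI1 assms(3) subset_empty)

section \<open>The logical rules as conditions on definable closures\<close>

text \<open>
  The common ground of both directions.  The set \<open>f X\<close> may fail to be definable, and the logic only sees
  \<open>dclosure V (f X)\<close>.
\<close>

locale generated_logic =
  fixes V :: "'v set" and nm :: "'v logic" and f :: "'v model_fun"
  assumes ncl_eq: "T \<subseteq> lang V \<Longrightarrow> ncl V nm T = Th V (f (Mod V T))"
    and f_models: "X \<in> DL V \<Longrightarrow> f X \<subseteq> models V"
begin

lemma nm_iff: "T \<subseteq> lang V \<Longrightarrow> \<phi> \<in> lang V \<Longrightarrow> nm T \<phi> \<longleftrightarrow> f (Mod V T) \<subseteq> Mod V {\<phi>}"
  using ncl_eq[of T] f_models[of "Mod V T"]
  by (auto simp: ncl_def Th_def Mod_def DL_def)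

lemma Mod_ncl: "T \<subseteq> lang V \<Longrightarrow> Mod V (ncl V nm T) = dclosure V (f (Mod V T))"
  by (simp add: ncl_eq dclosure_def)

lemma f_Mod_models: "T \<subseteq> lang V \<Longrightarrow> f (Mod V T) \<subseteq> models V"
  by (simp add: f_models Mod_in_DL)

lemma ncl_or_theory:
  "T \<subseteq> lang V \<Longrightarrow> T' \<subseteq> lang V \<Longrightarrow> ncl V nm (T \<or>\<^sub>T T') = Th V (f (Mod V T \<union> Mod V T'))"
  by (simp add: ncl_eq or_theory_subset_lang Mod_or_theory)

lemma ncl_Un:
  "T \<subseteq> lang V \<Longrightarrow> T' \<subseteq> lang V \<Longrightarrow> ncl V nm (T \<union> T') = Th V (f (Mod V T \<inter> Mod V T'))"
  by (simp add: ncl_eq Mod_Un)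

lemmas f_Un_models = f_models[OF DL_Un[OF Mod_in_DL Mod_in_DL]]
lemmas f_Int_models = f_models[OF DL_Int[OF Mod_in_DL Mod_in_DL]]

lemma subset_ncl_iff:
  "T \<subseteq> lang V \<Longrightarrow> T' \<subseteq> lang V \<Longrightarrow> T' \<subseteq> ncl V nm T \<longleftrightarrow> f (Mod V T) \<subseteq> Mod V T'"
  by (simp add: ncl_eq subset_Th_iff f_Mod_models)

lemma Cn_subset_ncl_iff:
  assumes "T \<subseteq> lang V" "T' \<subseteq> lang V"
  shows "Cn V T' \<subseteq> ncl V nm T \<longleftrightarrow> f (Mod V T) \<subseteq> Mod V T'"
  using assms by (simp add: ncl_eq Cn_eq_Th_Mod Th_subset_Th_iff f_Mod_models dclosure_eq Mod_in_DL)

lemma subset_Cn_iff: "T \<subseteq> lang V \<Longrightarrow> T \<subseteq> Cn V T' \<longleftrightarrow> Mod V T' \<subseteq> Mod V T"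
  by (simp add: Cn_eq_Th_Mod subset_Th_iff Mod_subset_models)

lemma LLE_of_ncl_eq: "LLE V nm"
  by (simp add: LLE_def Cn_eq_Cn_iff ncl_eq)

lemma CCL_of_ncl_eq: "CCL V nm"
  by (simp add: CCL_def Cn_eq_Th_Mod Mod_ncl Th_dclosure f_Mod_models) (simp add: ncl_eq)

text \<open>
  In the equivalences below, \<open>X\<close> and \<open>Y\<close> stand for the model sets of the two theories of the rule.
  A set on the larger side of an inclusion acquires a closure, since a formula valid in the set is
  valid in its closure, too.
\<close>

lemma OR_iff: "OR V nm \<longleftrightarrow> (\<forall>X\<in>DL V. \<forall>Y\<in>DL V. f (X \<union> Y) \<subseteq> dclosure V (f X \<union> f Y))"
  unfolding OR_def ball_DL_iff
  by (simp add: ncl_or_theory ncl_eq flip: Th_Un) (simp add: Th_subset_Th_iff f_Un_models; blast)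

lemma disjOR_iff: "disjOR V nm \<longleftrightarrow>
    (\<forall>X\<in>DL V. \<forall>Y\<in>DL V. X \<inter> Y = {} \<longrightarrow> f (X \<union> Y) \<subseteq> dclosure V (f X \<union> f Y))"
  unfolding disjOR_def ball_DL_iff Con_iff_Mod Mod_Un
  by (simp add: ncl_or_theory ncl_eq flip: Th_Un) (simp add: Th_subset_Th_iff f_Un_models; blast)

lemma wOR_iff: "wOR V nm \<longleftrightarrow> (\<forall>X\<in>DL V. \<forall>Y\<in>DL V. f (X \<union> Y) \<subseteq> dclosure V (f X \<union> Y))"
  unfolding wOR_def ball_DL_iff Cn_eq_Th_Mod
  by (simp add: ncl_or_theory ncl_eq flip: Th_Un) (simp add: Th_subset_Th_iff f_Un_models; blast)

lemma SC_iff: "SC V nm \<longleftrightarrow> mu_sub (DL V) f"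
  unfolding SC_def mu_sub_def ball_DL_iff by (simp add: Cn_subset_ncl_iff)

lemma CP_iff: "CP V nm \<longleftrightarrow> mu_empty (DL V) f"
proof -
  have "Bot \<in> lang V" "Mod V {Bot} = {}"
    by (auto simp: lang_def Mod_def)
  then show ?thesis
    unfolding CP_def mu_empty_def ball_DL_iff entails_def by (auto simp: nm_iff)
qed

lemma CUT_iff: "CUT V nm \<longleftrightarrow>
    (\<forall>X\<in>DL V. \<forall>Y\<in>DL V. f X \<subseteq> Y \<longrightarrow> Y \<subseteq> X \<longrightarrow> f X \<subseteq> dclosure V (f Y))"
  unfolding CUT_def ball_DL_iff
  by (simp add: subset_Cn_iff Cn_subset_ncl_iff)
    (simp add: ncl_eq Th_subset_Th_iff f_Mod_models; blast)

lemma CM_iff: "CM V nm \<longleftrightarrow>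
    (\<forall>X\<in>DL V. \<forall>Y\<in>DL V. f X \<subseteq> Y \<longrightarrow> Y \<subseteq> X \<longrightarrow> f Y \<subseteq> dclosure V (f X))"
  unfolding CM_def ball_DL_iff
  by (simp add: subset_Cn_iff Cn_subset_ncl_iff)
    (simp add: ncl_eq Th_subset_Th_iff f_Mod_models; blast)

lemma CUM_iff: "CUM V nm \<longleftrightarrow>
    (\<forall>X\<in>DL V. \<forall>Y\<in>DL V. f X \<subseteq> Y \<longrightarrow> Y \<subseteq> X \<longrightarrow> dclosure V (f X) = dclosure V (f Y))"
  unfolding CUM_def ball_DL_iff
  by (simp add: subset_Cn_iff Cn_subset_ncl_iff)
    (simp add: ncl_eq Th_eq_Th_iff f_Mod_models; blast)

lemma SubSup_iff: "SubSup V nm \<longleftrightarrow>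
    (\<forall>X\<in>DL V. \<forall>Y\<in>DL V. f X \<subseteq> Y \<longrightarrow> f Y \<subseteq> X \<longrightarrow> dclosure V (f X) = dclosure V (f Y))"
  unfolding SubSup_def ball_DL_iff
  by (simp add: subset_ncl_iff) (simp add: ncl_eq Th_eq_Th_iff f_Mod_models; metis)

lemma ResM_iff: "ResM V nm \<longleftrightarrow> mu_ResM V (DL V) f"
proof -
  have "mu_ResM V (DL V) f \<longleftrightarrow> (\<forall>X\<in>DL V. \<forall>\<alpha>\<in>lang V. \<forall>\<beta>\<in>lang V.
      f X \<subseteq> Mod V {\<alpha>} \<longrightarrow> f X \<subseteq> Mod V {\<beta>} \<longrightarrow> f (X \<inter> Mod V {\<alpha>}) \<subseteq> Mod V {\<beta>})"
    by (auto simp: mu_ResM_def DL_Int Mod_in_DL)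
  moreover have "nm (\<Delta> \<union> {\<alpha>}) \<beta> \<longleftrightarrow> f (Mod V \<Delta> \<inter> Mod V {\<alpha>}) \<subseteq> Mod V {\<beta>}"
    if "\<Delta> \<subseteq> lang V" "\<alpha> \<in> lang V" "\<beta> \<in> lang V" for \<Delta> \<alpha> \<beta>
    using that nm_iff[of "\<Delta> \<union> {\<alpha>}" \<beta>] unfolding Mod_Un by blast
  ultimately show ?thesis
    unfolding ResM_def ball_DL_iff by (simp add: nm_iff del: Un_insert_right) blast
qed

text \<open>
  In the next four rules a closure appears inside an intersection: for example, the models of
  \<open>ncl V nm T \<union> T'\<close> are those of \<open>T'\<close> in the closure of \<open>f (Mod V T)\<close>, not only those in
  \<open>f (Mod V T)\<close> itself.
\<close>

lemma PR_at_iff: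
  assumes "T \<subseteq> lang V" "T' \<subseteq> lang V"
  shows "PR_at V nm T T' \<longleftrightarrow>
    dclosure V (f (Mod V T)) \<inter> Mod V T' \<subseteq> dclosure V (f (Mod V T \<inter> Mod V T'))"
  using assms unfolding PR_at_def Cn_eq_Th_Mod
  by (simp add: Mod_Un Mod_ncl ncl_Un Th_subset_Th_iff Mod_subset_models le_infI2)

lemma RatM_at_iff:
  assumes "T \<subseteq> lang V" "T' \<subseteq> lang V"
  shows "RatM_at V nm T T' \<longleftrightarrow>
    (Mod V T \<subseteq> Mod V T' \<longrightarrow> dclosure V (f (Mod V T')) \<inter> Mod V T \<noteq> {} \<longrightarrow>
     f (Mod V T) \<subseteq> dclosure V (f (Mod V T')) \<inter> Mod V T)"
proof -
  have "(\<forall>\<phi>\<in>T'. entails V T \<phi>) \<longleftrightarrow> Mod V T \<subseteq> Mod V T'"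
    by (auto simp: entails_def Mod_def)
  then show ?thesis
    using assms unfolding RatM_at_def Con_iff_Mod Cn_eq_Th_Mod
    by (simp add: Mod_Un ncl_eq flip: dclosure_def)
      (simp add: Th_subset_Th_iff f_Mod_models dclosure_eq DL_Int
        dclosure_in_DL Mod_in_DL Int_commute; blast)
qed

lemma RatMeq_at_iff:
  assumes "T \<subseteq> lang V" "T' \<subseteq> lang V"
  shows "RatMeq_at V nm T T' \<longleftrightarrow>
    (Mod V T \<subseteq> Mod V T' \<longrightarrow> dclosure V (f (Mod V T')) \<inter> Mod V T \<noteq> {} \<longrightarrow>
     dclosure V (f (Mod V T)) = dclosure V (f (Mod V T')) \<inter> Mod V T)"
proof -
  have "(\<forall>\<phi>\<in>T'. entails V T \<phi>) \<longleftrightarrow> Mod V T \<subseteq> Mod V T'"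
    by (auto simp: entails_def Mod_def)
  then show ?thesis
    using assms unfolding RatMeq_at_def Con_iff_Mod Cn_eq_Th_Mod
    by (simp add: Mod_Un ncl_eq flip: dclosure_def)
      (simp add: Th_eq_Th_iff f_Mod_models dclosure_eq DL_Int
        dclosure_in_DL Mod_in_DL Int_commute Mod_subset_models le_infI1; blast)
qed

lemma LogEq'_at_iff:
  assumes "T \<subseteq> lang V" "T' \<subseteq> lang V"
  shows "LogEq'_at V nm T T' \<longleftrightarrow>
    (dclosure V (f (Mod V T')) \<inter> Mod V T \<noteq> {} \<longrightarrow>
     dclosure V (f (Mod V T' \<inter> Mod V T)) = dclosure V (f (Mod V T')) \<inter> Mod V T)"
  using assms unfolding LogEq'_at_def Con_iff_Mod Cn_eq_Th_Mod
  by (simp add: Mod_Un Mod_ncl ncl_Un Th_eq_Th_iff f_Int_models dclosure_eq DL_Int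
      dclosure_in_DL Mod_in_DL Int_commute Mod_subset_models le_infI1)

lemma LogPar_iff: "LogPar V nm \<longleftrightarrow> (\<forall>X\<in>DL V. \<forall>Y\<in>DL V.
    dclosure V (f (X \<union> Y)) = dclosure V (f X) \<or> dclosure V (f (X \<union> Y)) = dclosure V (f Y) \<or>
    dclosure V (f (X \<union> Y)) = dclosure V (f X \<union> f Y))"
  unfolding LogPar_def ball_DL_iff
  by (simp add: ncl_or_theory ncl_eq flip: Th_Un)
    (simp add: Th_eq_Th_iff f_Un_models f_Mod_models; blast)

lemma LogCup_iff: "LogCup V nm \<longleftrightarrow> (\<forall>X\<in>DL V. \<forall>Y\<in>DL V.
    dclosure V (f Y) \<inter> X \<noteq> {} \<longrightarrow> dclosure V (f Y) \<inter> dclosure V (f X) = {} \<longrightarrow>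
    dclosure V (f (X \<union> Y)) \<inter> Y = {})"
  unfolding LogCup_def ball_DL_iff Con_iff_Mod Mod_Un
  by (simp add: Mod_ncl or_theory_subset_lang Mod_or_theory; blast)

lemma LogCup'_iff: "LogCup' V nm \<longleftrightarrow> (\<forall>X\<in>DL V. \<forall>Y\<in>DL V.
    dclosure V (f Y) \<inter> X \<noteq> {} \<longrightarrow> dclosure V (f Y) \<inter> dclosure V (f X) = {} \<longrightarrow>
    dclosure V (f (X \<union> Y)) = dclosure V (f X))"
  unfolding LogCup'_def ball_DL_iff Con_iff_Mod Mod_Un
  by (simp add: Mod_ncl ncl_or_theory) (simp add: ncl_eq Th_eq_Th_iff f_Un_models f_Mod_models; blast)

lemma PR_iff: "PR V nm \<longleftrightarrow>
    (\<forall>X\<in>DL V. \<forall>Y\<in>DL V. dclosure V (f X) \<inter> Y \<subseteq> dclosure V (f (X \<inter> Y)))"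
  unfolding PR_def ball_DL_iff by (simp add: PR_at_iff; blast)

lemma RatM_iff: "RatM V nm \<longleftrightarrow> (\<forall>X\<in>DL V. \<forall>Y\<in>DL V.
    X \<subseteq> Y \<longrightarrow> dclosure V (f Y) \<inter> X \<noteq> {} \<longrightarrow> f X \<subseteq> dclosure V (f Y) \<inter> X)"
  unfolding RatM_def ball_DL_iff by (simp add: RatM_at_iff; blast)

lemma RatMeq_iff: "RatMeq V nm \<longleftrightarrow> (\<forall>X\<in>DL V. \<forall>Y\<in>DL V.
    X \<subseteq> Y \<longrightarrow> dclosure V (f Y) \<inter> X \<noteq> {} \<longrightarrow> dclosure V (f X) = dclosure V (f Y) \<inter> X)"
  unfolding RatMeq_def ball_DL_iff by (simp add: RatMeq_at_iff; blast)

lemma LogEq'_iff: "LogEq' V nm \<longleftrightarrow> (\<forall>X\<in>DL V. \<forall>Y\<in>DL V.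
    dclosure V (f Y) \<inter> X \<noteq> {} \<longrightarrow> dclosure V (f (Y \<inter> X)) = dclosure V (f Y) \<inter> X)"
  unfolding LogEq'_def ball_DL_iff by (simp add: LogEq'_at_iff; blast)

section \<open>Algebraic conditions whose logical rule follows for every function\<close>

text \<open>
  Here the closures enlarge the right-hand side of an inclusion or are applied to both sides of an
  equation, so the algebraic conditions are the stronger ones.
\<close>

lemma OR_of_mu_OR: "mu_OR (DL V) f \<Longrightarrow> OR V nm"
  unfolding OR_iff mu_OR_def
  by (meson DL_Un Un_least f_models order_trans subset_dclosure)

lemma disjOR_of_mu_disjOR: "mu_disjOR (DL V) f \<Longrightarrow> disjOR V nm"
  unfolding disjOR_iff mu_disjOR_def
  by (meson DL_Un Un_least f_models order_trans subset_dclosure)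

lemma wOR_of_mu_wOR: "mu_wOR (DL V) f \<Longrightarrow> wOR V nm"
  unfolding wOR_iff mu_wOR_def
  by (meson DL_Un DL_subset_models Un_least f_models order_trans subset_dclosure)

lemma CUT_of_mu_CUT: "mu_CUT (DL V) f \<Longrightarrow> CUT V nm"
  unfolding CUT_iff mu_CUT_def by (meson f_models order_trans subset_dclosure)

lemma CM_of_mu_CM: "mu_CM (DL V) f \<Longrightarrow> CM V nm"
  unfolding CM_iff mu_CM_def by (meson f_models order_trans subset_dclosure)

lemma CUM_of_mu_CUM: "mu_CUM (DL V) f \<Longrightarrow> CUM V nm"
  unfolding CUM_iff mu_CUM_def by metis

lemma SubSup_of_mu_SubSup: "mu_SubSup (DL V) f \<Longrightarrow> SubSup V nm"
  unfolding SubSup_iff mu_SubSup_def by metis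

lemma LogPar_of_mu_par: "mu_par (DL V) f \<Longrightarrow> LogPar V nm"
  unfolding LogPar_iff mu_par_def by (metis DL_Un)

section \<open>Theories equivalent to a single formula\<close>

text \<open>
  The theory whose model set is intersected with a closure is \<open>T'\<close> in \<open>PR\<close> and \<open>T\<close> in the
  rationality rules.  If it amounts to a formula, the closure can be pulled out of the intersection.
\<close>

lemma PR_at_formula:
  assumes "mu_PR' (DL V) f" "T \<subseteq> lang V" "T' \<subseteq> lang V" "is_formula V T'"
  shows "PR_at V nm T T'"
  using assms unfolding mu_PR'_def
  by (simp add: PR_at_iff dclosure_Int_formula_theory f_Mod_models dclosure_mono Mod_in_DL DL_Int)

lemma RatM_at_formula:
  assumes "mu_RatM (DL V) f" "T \<subseteq> lang V" "T' \<subseteq> lang V" "is_formula V T"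
  shows "RatM_at V nm T T'"
proof -
  let ?X = "Mod V T" and ?Y = "Mod V T'"
  have "f ?X \<subseteq> dclosure V (f ?Y) \<inter> ?X" if "?X \<subseteq> ?Y" "f ?Y \<inter> ?X \<noteq> {}"
  proof -
    have "f ?X \<subseteq> f ?Y \<inter> ?X"
      using assms(1) that Mod_in_DL[OF assms(2)] Mod_in_DL[OF assms(3)]
      unfolding mu_RatM_def by blast
    then show ?thesis
      using subset_dclosure[OF f_Mod_models[OF assms(3)]] by blast
  qed
  then show ?thesis
    using assms by (simp add: RatM_at_iff dclosure_Int_formula_theory_empty_iff f_Mod_models)
qed

lemma RatMeq_at_formula:
  assumes "mu_eq (DL V) f" "T \<subseteq> lang V" "T' \<subseteq> lang V" "is_formula V T"
  shows "RatMeq_at V nm T T'"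
proof -
  let ?X = "Mod V T" and ?Y = "Mod V T'"
  have "f ?X = f ?Y \<inter> ?X" if "?X \<subseteq> ?Y" "f ?Y \<inter> ?X \<noteq> {}"
    using assms(1) that Mod_in_DL[OF assms(2)] Mod_in_DL[OF assms(3)]
    unfolding mu_eq_def by blast
  then show ?thesis
    using assms by (simp add: RatMeq_at_iff dclosure_Int_formula_theory f_Mod_models
        dclosure_empty) (metis dclosure_empty)
qed

lemma LogEq'_at_formula:
  assumes "mu_eq' (DL V) f" "T \<subseteq> lang V" "T' \<subseteq> lang V" "is_formula V T"
  shows "LogEq'_at V nm T T'"
  using assms unfolding mu_eq'_def
  by (simp add: LogEq'_at_iff dclosure_Int_formula_theory_empty_iff f_Mod_models Mod_in_DL DL_Int)
    (simp add: dclosure_Int_formula_theory f_Mod_models)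

end

section \<open>Functions preserving definability\<close>

locale definable_generated_logic = generated_logic +
  assumes f_DL: "X \<in> DL V \<Longrightarrow> f X \<in> DL V"
begin

lemma f_Mod_eq: "T \<subseteq> lang V \<Longrightarrow> f (Mod V T) = Mod V (ncl V nm T)"
  by (simp add: Mod_ncl dclosure_eq f_DL Mod_in_DL)

lemma OR_iff_mu_OR: "OR V nm \<longleftrightarrow> mu_OR (DL V) f"
  by (simp add: OR_iff mu_OR_def dclosure_eq f_DL DL_Un)

lemma disjOR_iff_mu_disjOR: "disjOR V nm \<longleftrightarrow> mu_disjOR (DL V) f"
  by (simp add: disjOR_iff mu_disjOR_def dclosure_eq f_DL DL_Un)

lemma wOR_iff_mu_wOR: "wOR V nm \<longleftrightarrow> mu_wOR (DL V) f"
  by (simp add: wOR_iff mu_wOR_def dclosure_eq f_DL DL_Un)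

text \<open>
  \<open>PR\<close> speaks about arbitrary pairs of theories, that is, about \<open>X \<inter> Y\<close> rather than about a subset of
  \<open>X\<close>; hence its exact companion is \<open>mu_PR'\<close>.
\<close>

lemma PR_iff_mu_PR': "PR V nm \<longleftrightarrow> mu_PR' (DL V) f"
  by (simp add: PR_iff mu_PR'_def dclosure_eq f_DL DL_Int)

lemma CUT_iff_mu_CUT: "CUT V nm \<longleftrightarrow> mu_CUT (DL V) f"
  by (simp add: CUT_iff mu_CUT_def dclosure_eq f_DL)

lemma CM_iff_mu_CM: "CM V nm \<longleftrightarrow> mu_CM (DL V) f"
  by (simp add: CM_iff mu_CM_def dclosure_eq f_DL)

lemma CUM_iff_mu_CUM: "CUM V nm \<longleftrightarrow> mu_CUM (DL V) f"
  by (simp add: CUM_iff mu_CUM_def dclosure_eq f_DL; metis)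

lemma SubSup_iff_mu_SubSup: "SubSup V nm \<longleftrightarrow> mu_SubSup (DL V) f"
  by (simp add: SubSup_iff mu_SubSup_def dclosure_eq f_DL)

lemma RatM_iff_mu_RatM: "RatM V nm \<longleftrightarrow> mu_RatM (DL V) f"
  by (simp add: RatM_iff mu_RatM_def dclosure_eq f_DL Int_commute)

lemma RatMeq_iff_mu_eq: "RatMeq V nm \<longleftrightarrow> mu_eq (DL V) f"
  by (simp add: RatMeq_iff mu_eq_def dclosure_eq f_DL Int_commute)

lemma LogEq'_iff_mu_eq': "LogEq' V nm \<longleftrightarrow> mu_eq' (DL V) f"
  by (simp add: LogEq'_iff mu_eq'_def dclosure_eq f_DL DL_Int)

lemma LogPar_iff_mu_par: "LogPar V nm \<longleftrightarrow> mu_par (DL V) f"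
  by (simp add: LogPar_iff mu_par_def dclosure_eq f_DL DL_Un)

text \<open>
  The premises of the union rules say that \<open>f Y\<close> meets \<open>X\<close> and misses \<open>f X\<close> altogether.  This is
  stronger than the premise of \<open>mu_cup\<close>, by which \<open>f Y\<close> contains a point of \<open>X\<close> outside \<open>f X\<close>.
\<close>

lemma LogCup_iff_definable: "LogCup V nm \<longleftrightarrow> (\<forall>X\<in>DL V. \<forall>Y\<in>DL V.
    f Y \<inter> X \<noteq> {} \<longrightarrow> f Y \<inter> f X = {} \<longrightarrow> f (X \<union> Y) \<inter> Y = {})"
  by (simp add: LogCup_iff dclosure_eq f_DL DL_Un)

lemma LogCup'_iff_definable: "LogCup' V nm \<longleftrightarrow> (\<forall>X\<in>DL V. \<forall>Y\<in>DL V.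
    f Y \<inter> X \<noteq> {} \<longrightarrow> f Y \<inter> f X = {} \<longrightarrow> f (X \<union> Y) = f X)"
  by (simp add: LogCup'_iff dclosure_eq f_DL DL_Un)

lemma LogCup_of_mu_cup: "mu_cup (DL V) f \<Longrightarrow> LogCup V nm"
  unfolding LogCup_iff_definable mu_cup_def using DL_Un by blast

lemma LogCup'_of_mu_cup': "mu_cup' (DL V) f \<Longrightarrow> LogCup' V nm"
  unfolding LogCup'_iff_definable mu_cup'_def
  by (simp add: DL_Un) blast

text \<open>
  If \<open>f X\<close> and \<open>f Y\<close> had a common point, \<open>mu_eq\<close> would compute \<open>f (X \<inter> Y)\<close> both from \<open>X\<close> and from \<open>Y\<close>,
  so that \<open>f X\<close> and \<open>f Y\<close> would agree on \<open>X \<inter> Y\<close>.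
\<close>

lemma f_disjoint_of_mu_eq:
  assumes "mu_sub (DL V) f" "mu_eq (DL V) f"
    and "X \<in> DL V" "Y \<in> DL V" "f Y \<inter> (X - f X) \<noteq> {}"
  shows "f Y \<inter> f X = {}"
proof (rule ccontr)
  assume "f Y \<inter> f X \<noteq> {}"
  have XY: "X \<inter> Y \<in> DL V" "f X \<subseteq> X" "f Y \<subseteq> Y"
    using assms by (auto simp: DL_Int mu_sub_def)
  have "X \<inter> Y \<inter> f Y \<noteq> {}" "X \<inter> Y \<inter> f X \<noteq> {}"
    using \<open>f Y \<inter> f X \<noteq> {}\<close> XY by blast+
  then have "f (X \<inter> Y) = f Y \<inter> (X \<inter> Y)" "f (X \<inter> Y) = f X \<inter> (X \<inter> Y)"
    using assms(2-4) XY(1) unfolding mu_eq_def by blast+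
  then show False
    using assms(5) XY by blast
qed

lemma mu_cup_of_LogCup:
  assumes "LogCup V nm" "mu_sub (DL V) f" "mu_eq (DL V) f"
  shows "mu_cup (DL V) f"
  unfolding mu_cup_def
proof (intro ballI impI)
  fix X Y
  assume XY: "X \<in> DL V" "Y \<in> DL V" and ne: "f Y \<inter> (X - f X) \<noteq> {}"
  have "f Y \<inter> f X = {}" "f Y \<inter> X \<noteq> {}"
    using f_disjoint_of_mu_eq[OF assms(2,3) XY ne] ne by auto
  then show "f (X \<union> Y) \<inter> Y = {}"
    using assms(1) XY unfolding LogCup_iff_definable by blast
qed

lemma mu_cup'_of_LogCup':
  assumes "LogCup' V nm" "mu_sub (DL V) f" "mu_eq (DL V) f"
  shows "mu_cup' (DL V) f"
  unfolding mu_cup'_def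
proof (intro ballI impI)
  fix X Y
  assume XY: "X \<in> DL V" "Y \<in> DL V" and ne: "f Y \<inter> (X - f X) \<noteq> {}"
  have "f Y \<inter> f X = {}" "f Y \<inter> X \<noteq> {}"
    using f_disjoint_of_mu_eq[OF assms(2,3) XY ne] ne by auto
  then show "f (X \<union> Y) = f X"
    using assms(1) XY unfolding LogCup'_iff_definable by blast
qed

end

lemma mu_PR'_of_mu_PR:
  assumes "mu_PR (DL V) f" "mu_sub (DL V) f"
  shows "mu_PR' (DL V) f"
  unfolding mu_PR'_def
proof (intro ballI impI)
  fix X Y
  assume "X \<in> DL V" "Y \<in> DL V" "X \<inter> Y \<in> DL V"
  then have "f X \<inter> (X \<inter> Y) \<subseteq> f (X \<inter> Y)" "f X \<subseteq> X"
    using assms unfolding mu_PR_def mu_sub_def by simp_all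
  then show "f X \<inter> Y \<subseteq> f (X \<inter> Y)"
    by blast
qed

lemma mu_PR_of_mu_PR': "mu_PR' (DL V) f \<Longrightarrow> mu_PR (DL V) f"
  unfolding mu_PR_def mu_PR'_def by (metis inf.absorb2)

section \<open>From logics to functions and back\<close>

text \<open>
  \<open>LLE\<close> makes the value at \<open>X\<close> independent of the theory chosen to define \<open>X\<close>; the largest one,
  \<open>Th V X\<close>, serves as a canonical choice.
\<close>

lemma unique_representing_function:
  assumes "LLE V nm" "CCL V nm"
  shows "\<exists>!f. f \<in> DL V \<rightarrow>\<^sub>E DL V \<and> represents V nm f"
proof (rule ex1I)
  let ?f = "restrict (\<lambda>X. Mod V (ncl V nm (Th V X))) (DL V)"
  have "ncl V nm (Th V (Mod V T)) = ncl V nm T" if "T \<subseteq> lang V" for T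
  proof -
    have "Mod V (Th V (Mod V T)) = Mod V T"
      using dclosure_eq[OF Mod_in_DL[OF that]] by (simp add: dclosure_def)
    then have "Cn V (Th V (Mod V T)) = Cn V T"
      by (simp add: Cn_eq_Th_Mod)
    then show ?thesis
      using assms(1)[unfolded LLE_def, rule_format, OF Th_subset_lang that] by simp
  qed
  moreover have "Mod V (ncl V nm T) \<in> DL V" for T
    by (rule Mod_in_DL) (auto simp: ncl_def)
  ultimately show "?f \<in> DL V \<rightarrow>\<^sub>E DL V \<and> represents V nm ?f"
    by (auto simp: represents_def Mod_in_DL)
next
  let ?f = "restrict (\<lambda>X. Mod V (ncl V nm (Th V X))) (DL V)"
  fix g
  assume g: "g \<in> DL V \<rightarrow>\<^sub>E DL V \<and> represents V nm g"
  show "g = ?f"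
  proof
    fix X
    show "g X = ?f X"
    proof (cases "X \<in> DL V")
      case True
      then have "Mod V (Th V X) = X"
        using dclosure_eq by (simp add: dclosure_def)
      then show ?thesis
        using True g Th_subset_lang unfolding represents_def by (metis restrict_apply')
    next
      case False
      then show ?thesis
        using g PiE_arb[of g] by auto
    qed
  qed
qed

text \<open>\<open>CCL\<close> is what recovers the consequences of \<open>T\<close> from their model set.\<close>

lemma definable_generated_logic_of_represents:
  assumes "CCL V nm" "represents V nm f"
  shows "definable_generated_logic V nm f"
proof
  have ncl_lang: "ncl V nm T \<subseteq> lang V" for T
    by (auto simp: ncl_def)
  show "ncl V nm T = Th V (f (Mod V T))" if "T \<subseteq> lang V" for T
    using assms that by (simp add: CCL_def represents_def Cn_eq_Th_Mod)
  show "f X \<in> DL V" if "X \<in> DL V" for X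
    using that assms(2) Mod_in_DL[OF ncl_lang] by (auto simp: DL_def[of V] represents_def)
  then show "f X \<subseteq> models V" if "X \<in> DL V" for X
    using that DL_subset_models by blast
qed

lemma generated_logic_of:
  assumes "model_fun_on V D f"
  shows "generated_logic V (logic_of V f) f"
proof
  show "ncl V (logic_of V f) T = Th V (f (Mod V T))" for T
    by (auto simp: ncl_def logic_of_def Th_def)
  show "f X \<subseteq> models V" if "X \<in> DL V" for X
    using assms that by (auto simp: model_fun_on_def)
qed

lemma definable_generated_logic_of:
  assumes "model_fun_on V D f" "mu_dp V D f"
  shows "definable_generated_logic V (logic_of V f) f"
proof -
  interpret generated_logic V "logic_of V f" f
    using assms(1) by (rule generated_logic_of)
  show ?thesis
    using assms by unfold_locales (auto simp: mu_dp_def model_fun_on_def)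
qed

text \<open>
  The logic obtained from \<open>f\<close> depends only on the values of \<open>f\<close> on definable sets, so it suffices to
  have the algebraic conditions there.
\<close>

lemma algebraic_conditions_restrict:
  assumes "DL V \<subseteq> D"
  shows "mu_OR D f \<Longrightarrow> mu_OR (DL V) f"
    and "mu_disjOR D f \<Longrightarrow> mu_disjOR (DL V) f"
    and "mu_wOR D f \<Longrightarrow> mu_wOR (DL V) f"
    and "mu_sub D f \<Longrightarrow> mu_sub (DL V) f"
    and "mu_empty D f \<Longrightarrow> mu_empty (DL V) f"
    and "mu_PR D f \<Longrightarrow> mu_PR (DL V) f"
    and "mu_PR' D f \<Longrightarrow> mu_PR' (DL V) f"
    and "mu_CUT D f \<Longrightarrow> mu_CUT (DL V) f"
    and "mu_CM D f \<Longrightarrow> mu_CM (DL V) f"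
    and "mu_ResM V D f \<Longrightarrow> mu_ResM V (DL V) f"
    and "mu_SubSup D f \<Longrightarrow> mu_SubSup (DL V) f"
    and "mu_CUM D f \<Longrightarrow> mu_CUM (DL V) f"
    and "mu_RatM D f \<Longrightarrow> mu_RatM (DL V) f"
    and "mu_eq D f \<Longrightarrow> mu_eq (DL V) f"
    and "mu_eq' D f \<Longrightarrow> mu_eq' (DL V) f"
    and "mu_par D f \<Longrightarrow> mu_par (DL V) f"
    and "mu_cup D f \<Longrightarrow> mu_cup (DL V) f"
    and "mu_cup' D f \<Longrightarrow> mu_cup' (DL V) f"
  using assms unfolding mu_OR_def mu_disjOR_def mu_wOR_def mu_sub_def mu_empty_def mu_PR_def mu_PR'_def
    mu_CUT_def mu_CM_def mu_ResM_def mu_SubSup_def mu_CUM_def mu_RatM_def mu_eq_def mu_eq'_def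
    mu_par_def mu_cup_def mu_cup'_def
  by blast+

section \<open>Functions that do not preserve definability\<close>

lemma finite_atoms: "finite (atoms \<phi>)"
  by (induction \<phi>) auto

lemma sat_cong: "m \<inter> atoms \<phi> = m' \<inter> atoms \<phi> \<Longrightarrow> sat m \<phi> = sat m' \<phi>"
proof (induction \<phi>)
  case (Conj \<phi> \<psi>)
  then have "m \<inter> atoms \<phi> = m' \<inter> atoms \<phi>" "m \<inter> atoms \<psi> = m' \<inter> atoms \<psi>"
    by auto
  then show ?case using Conj.IH by simp
next
  case (Disj \<phi> \<psi>)
  then have "m \<inter> atoms \<phi> = m' \<inter> atoms \<phi>" "m \<inter> atoms \<psi> = m' \<inter> atoms \<psi>"
    by auto
  then show ?case using Disj.IH by simp
next
  case (Impl \<phi> \<psi>)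
  then have "m \<inter> atoms \<phi> = m' \<inter> atoms \<phi>" "m \<inter> atoms \<psi> = m' \<inter> atoms \<psi>"
    by auto
  then show ?case using Impl.IH by simp
qed auto

text \<open>The model \<open>{}\<close>, in which every variable is false, is the one to be removed.\<close>

lemma DL_UNIV_nat: "UNIV \<in> DL (UNIV :: nat set)" "{{}} \<in> DL (UNIV :: nat set)"
proof -
  have "Mod UNIV {} = (UNIV :: nat set set)"
    by (auto simp: Mod_def models_def)
  then show "UNIV \<in> DL (UNIV :: nat set)"
    by (metis Mod_in_DL empty_subsetI)
  have "Mod UNIV (range (\<lambda>p. Neg (Atom p))) = {{} :: nat set}"
    by (auto simp: Mod_def models_def)
  then show "{{}} \<in> DL (UNIV :: nat set)"
    using Mod_in_DL[of "range (\<lambda>p. Neg (Atom p))" UNIV]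
    by (metis lang_def subset_UNIV UNIV_eq_I mem_Collect_eq)
qed

text \<open>
  Making true a variable that does not occur in \<open>\<phi>\<close> leads from the removed model to another one that
  \<open>\<phi>\<close> cannot tell apart from it.
\<close>

lemma dclosure_punctured: "dclosure UNIV (UNIV - {{}}) = (UNIV :: nat set set)"
proof -
  have "sat m \<phi>" if \<phi>: "\<phi> \<in> Th UNIV (UNIV - {{}})" for m :: "nat set" and \<phi>
  proof (cases "m = {}")
    case True
    obtain p where "p \<notin> atoms \<phi>"
      using finite_atoms ex_new_if_finite infinite_UNIV_nat by blast
    then have "sat {} \<phi> = sat {p} \<phi>"
      by (intro sat_cong) auto
    then show ?thesis
      using \<phi> True by (auto simp: Th_def)
  next
    case False
    then show ?thesis
      using \<phi> by (auto simp: Th_def)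
  qed
  then show ?thesis
    by (auto simp: dclosure_def Mod_def models_def)
qed

lemma punctured_not_DL: "UNIV - {{}} \<notin> DL (UNIV :: nat set)"
  using dclosure_eq dclosure_punctured by fastforce

definition punctured :: "nat model_fun" where
  "punctured X = X - {{}}"

lemma model_fun_on_UNIV: "model_fun_on UNIV UNIV (f :: nat model_fun)"
  by (auto simp: model_fun_on_def models_def)

lemma not_mu_dp_punctured: "\<not> mu_dp UNIV UNIV punctured"
  using DL_UNIV_nat(1) punctured_not_DL by (auto simp: mu_dp_def punctured_def)

interpretation punctured: generated_logic UNIV "logic_of UNIV punctured" punctured
  by (rule generated_logic_of[OF model_fun_on_UNIV])

lemma punctured_algebraic:
  "mu_PR UNIV punctured" "mu_sub UNIV punctured" "mu_eq UNIV punctured"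
  "mu_eq' UNIV punctured" "mu_cup UNIV punctured" "mu_cup' UNIV punctured"
  by (auto simp: mu_PR_def mu_sub_def mu_eq_def mu_eq'_def mu_cup_def mu_cup'_def punctured_def)

lemma punctured_closures:
  "dclosure UNIV (punctured UNIV) = UNIV" "dclosure UNIV (punctured {{}}) = {}"
  by (simp_all add: punctured_def dclosure_punctured dclosure_empty)

text \<open>
  Every one of these rules is refuted by the definable sets \<open>UNIV\<close> and \<open>{{}}\<close>: the closure of
  \<open>punctured UNIV\<close> meets \<open>{{}}\<close> in its only element, while \<open>punctured {{}}\<close> is empty.
\<close>

lemma punctured_violates_rules:
  "\<not> PR UNIV (logic_of UNIV punctured)"
  "\<not> RatMeq UNIV (logic_of UNIV punctured)"
  "\<not> LogEq' UNIV (logic_of UNIV punctured)"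
  "\<not> LogCup UNIV (logic_of UNIV punctured)"
  "\<not> LogCup' UNIV (logic_of UNIV punctured)"
proof -
  show "\<not> PR UNIV (logic_of UNIV punctured)"
    unfolding punctured.PR_iff
    using DL_UNIV_nat punctured_closures by (metis Int_UNIV_left insert_not_empty subset_empty)
  show "\<not> RatMeq UNIV (logic_of UNIV punctured)"
    unfolding punctured.RatMeq_iff
    using DL_UNIV_nat punctured_closures by (metis Int_UNIV_left insert_not_empty subset_UNIV)
  show "\<not> LogEq' UNIV (logic_of UNIV punctured)"
    unfolding punctured.LogEq'_iff
    using DL_UNIV_nat punctured_closures by (metis Int_UNIV_left insert_not_empty)
  show "\<not> LogCup UNIV (logic_of UNIV punctured)"
    unfolding punctured.LogCup_iff
    using DL_UNIV_nat punctured_closures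
    by (metis Int_UNIV_left Int_empty_right Un_UNIV_right UNIV_not_empty insert_not_empty)
  show "\<not> LogCup' UNIV (logic_of UNIV punctured)"
    unfolding punctured.LogCup'_iff
    using DL_UNIV_nat punctured_closures
    by (metis Int_UNIV_left Int_empty_right Un_UNIV_right UNIV_not_empty insert_not_empty)
qed

text \<open>
  An empty value at \<open>{{}}\<close> cannot violate \<open>RatM\<close>, which only bounds the values of the function from
  above.  Therefore \<open>{{}}\<close> receives a nonempty value outside itself.  This does not affect
  \<open>mu_RatM\<close>: no value contains \<open>{}\<close>, so its premise never holds with \<open>X = {{}}\<close>.
\<close>

definition displaced :: "nat model_fun" where
  "displaced X = (if X = {{}} then {UNIV} else X - {{}})"

interpretation displaced: generated_logic UNIV "logic_of UNIV displaced" displaced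
  by (rule generated_logic_of[OF model_fun_on_UNIV])

lemma displaced_UNIV: "displaced UNIV = UNIV - {{}}"
  by (auto simp: displaced_def)

lemma not_mu_dp_displaced: "\<not> mu_dp UNIV UNIV displaced"
  using DL_UNIV_nat(1) punctured_not_DL displaced_UNIV by (metis UNIV_I mu_dp_def)

lemma mu_RatM_displaced: "mu_RatM UNIV displaced"
  by (auto simp: mu_RatM_def displaced_def)

lemma not_RatM_displaced: "\<not> RatM UNIV (logic_of UNIV displaced)"
proof
  assume "RatM UNIV (logic_of UNIV displaced)"
  then have "displaced {{}} \<subseteq> {{}}"
    unfolding displaced.RatM_iff
    using DL_UNIV_nat displaced_UNIV dclosure_punctured
    by (metis Int_UNIV_left insert_not_empty subset_UNIV)
  then show False
    by (simp add: displaced_def)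
qed

section \<open>The correspondence\<close>

theorem proposition3p8:
  fixes V :: "'v set"
  shows
    "(\<forall>nm. LLE V nm \<and> CCL V nm \<longrightarrow>
        (\<exists>!f. f \<in> DL V \<rightarrow>\<^sub>E DL V \<and> represents V nm f) \<and>
        (\<forall>f. represents V nm f \<longrightarrow>
          mu_dp V (DL V) f \<and>
          (\<forall>T. T \<subseteq> lang V \<longrightarrow> ncl V nm T = Th V (f (Mod V T))) \<and>
          (OR V nm \<longrightarrow> mu_OR (DL V) f) \<and>
          (disjOR V nm \<longrightarrow> mu_disjOR (DL V) f) \<and>
          (wOR V nm \<longrightarrow> mu_wOR (DL V) f) \<and>
          (SC V nm \<longrightarrow> mu_sub (DL V) f) \<and>
          (CP V nm \<longrightarrow> mu_empty (DL V) f) \<and>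
          (PR V nm \<longrightarrow> mu_PR (DL V) f) \<and>
          (CUT V nm \<longrightarrow> mu_CUT (DL V) f) \<and>
          (CM V nm \<longrightarrow> mu_CM (DL V) f) \<and>
          (ResM V nm \<longrightarrow> mu_ResM V (DL V) f) \<and>
          (SubSup V nm \<longrightarrow> mu_SubSup (DL V) f) \<and>
          (CUM V nm \<longrightarrow> mu_CUM (DL V) f) \<and>
          (RatM V nm \<longrightarrow> mu_RatM (DL V) f) \<and>
          (RatMeq V nm \<longrightarrow> mu_eq (DL V) f) \<and>
          (LogEq' V nm \<longrightarrow> mu_eq' (DL V) f) \<and>
          (LogPar V nm \<longrightarrow> mu_par (DL V) f) \<and>
          (LogCup V nm \<and> mu_sub (DL V) f \<and> mu_eq (DL V) f \<longrightarrow> mu_cup (DL V) f) \<and>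
          (LogCup' V nm \<and> mu_sub (DL V) f \<and> mu_eq (DL V) f \<longrightarrow> mu_cup' (DL V) f))) \<and>
     (\<forall>D f. model_fun_on V D f \<longrightarrow>
        LLE V (logic_of V f) \<and> CCL V (logic_of V f) \<and>
        (mu_dp V D f \<longrightarrow>
          (\<forall>T. T \<subseteq> lang V \<longrightarrow> f (Mod V T) = Mod V (ncl V (logic_of V f) T))) \<and>
        (mu_OR D f \<longrightarrow> OR V (logic_of V f)) \<and>
        (mu_disjOR D f \<longrightarrow> disjOR V (logic_of V f)) \<and>
        (mu_wOR D f \<longrightarrow> wOR V (logic_of V f)) \<and>
        (mu_sub D f \<longrightarrow> SC V (logic_of V f)) \<and>
        (mu_empty D f \<longrightarrow> CP V (logic_of V f)) \<and>
        (mu_PR D f \<and> mu_dp V D f \<and> mu_sub D f \<longrightarrow> PR V (logic_of V f)) \<and>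
        (mu_PR D f \<and> mu_sub D f \<longrightarrow> 
          (\<forall>T T'. T \<subseteq> lang V \<longrightarrow> T' \<subseteq> lang V \<longrightarrow> is_formula V T' \<longrightarrow>
           PR_at V (logic_of V f) T T')) \<and>
        (mu_PR' D f \<longrightarrow> 
          (\<forall>T T'. T \<subseteq> lang V \<longrightarrow> T' \<subseteq> lang V \<longrightarrow> is_formula V T' \<longrightarrow>
           PR_at V (logic_of V f) T T')) \<and>
        (mu_CUT D f \<longrightarrow> CUT V (logic_of V f)) \<and>
        (mu_CM D f \<longrightarrow> CM V (logic_of V f)) \<and>
        (mu_ResM V D f \<longrightarrow> ResM V (logic_of V f)) \<and>
        (mu_SubSup D f \<longrightarrow> SubSup V (logic_of V f)) \<and>
        (mu_CUM D f \<longrightarrow> CUM V (logic_of V f)) \<and>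
        (mu_RatM D f \<and> mu_dp V D f \<longrightarrow> RatM V (logic_of V f)) \<and>
        (mu_RatM D f \<longrightarrow> 
          (\<forall>T T'. T \<subseteq> lang V \<longrightarrow> T' \<subseteq> lang V \<longrightarrow> is_formula V T \<longrightarrow>
           RatM_at V (logic_of V f) T T')) \<and>
        (mu_eq D f \<and> mu_dp V D f \<longrightarrow> RatMeq V (logic_of V f)) \<and>
        (mu_eq D f \<longrightarrow> 
          (\<forall>T T'. T \<subseteq> lang V \<longrightarrow> T' \<subseteq> lang V \<longrightarrow> is_formula V T \<longrightarrow>
           RatMeq_at V (logic_of V f) T T')) \<and>
        (mu_eq' D f \<and> mu_dp V D f \<longrightarrow> LogEq' V (logic_of V f)) \<and>
        (mu_eq' D f \<longrightarrow> 
          (\<forall>T T'. T \<subseteq> lang V \<longrightarrow> T' \<subseteq> lang V \<longrightarrow> is_formula V T \<longrightarrow>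
           LogEq'_at V (logic_of V f) T T')) \<and>
        (mu_par D f \<longrightarrow> LogPar V (logic_of V f)) \<and>
        (mu_cup D f \<and> mu_dp V D f \<longrightarrow> LogCup V (logic_of V f)) \<and>
        (mu_cup' D f \<and> mu_dp V D f \<longrightarrow> LogCup' V (logic_of V f))) \<and>
     (\<exists>(V :: nat set) D f. model_fun_on V D f \<and> mu_PR D f \<and> mu_sub D f \<and> \<not> mu_dp V D f \<and>
        \<not> PR V (logic_of V f)) \<and>
     (\<exists>(V :: nat set) D f. model_fun_on V D f \<and> mu_RatM D f \<and> \<not> mu_dp V D f \<and>
        \<not> RatM V (logic_of V f)) \<and>
     (\<exists>(V :: nat set) D f. model_fun_on V D f \<and> mu_eq D f \<and> \<not> mu_dp V D f \<and>
        \<not> RatMeq V (logic_of V f)) \<and>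
     (\<exists>(V :: nat set) D f. model_fun_on V D f \<and> mu_eq' D f \<and> \<not> mu_dp V D f \<and>
        \<not> LogEq' V (logic_of V f)) \<and>
     (\<exists>(V :: nat set) D f. model_fun_on V D f \<and> mu_cup D f \<and> \<not> mu_dp V D f \<and>
        \<not> LogCup V (logic_of V f)) \<and>
     (\<exists>(V :: nat set) D f. model_fun_on V D f \<and> mu_cup' D f \<and> \<not> mu_dp V D f \<and>
        \<not> LogCup' V (logic_of V f))"
  (is "(\<forall>nm. _ nm \<longrightarrow> _ nm \<and> (\<forall>f. _ nm f \<longrightarrow> ?rows_from_logic nm f)) \<and>
    (\<forall>D f. _ D f \<longrightarrow> ?rows_to_logic D f) \<and>
    ?no_PR \<and> ?no_RatM \<and> ?no_RatMeq \<and> ?no_LogEq' \<and> ?no_LogCup \<and> ?no_LogCup'")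
proof -
  have from_logic: "?rows_from_logic nm f" if "CCL V nm" "represents V nm f" for nm f
  proof -
    interpret definable_generated_logic V nm f
      using that by (rule definable_generated_logic_of_represents)
    show ?thesis
      using OR_iff_mu_OR disjOR_iff_mu_disjOR wOR_iff_mu_wOR SC_iff CP_iff PR_iff_mu_PR'
        mu_PR_of_mu_PR'[of V f] CUT_iff_mu_CUT CM_iff_mu_CM ResM_iff SubSup_iff_mu_SubSup
        CUM_iff_mu_CUM RatM_iff_mu_RatM RatMeq_iff_mu_eq LogEq'_iff_mu_eq' LogPar_iff_mu_par
        mu_cup_of_LogCup mu_cup'_of_LogCup'
      by (simp add: mu_dp_def f_DL ncl_eq)
  qed
  have to_logic: "?rows_to_logic D f" if f: "model_fun_on V D f" for D f
  proof -
    have D: "DL V \<subseteq> D"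
      using f by (simp add: model_fun_on_def)
    interpret generated_logic V "logic_of V f" f
      using f by (rule generated_logic_of)
    have dp: "definable_generated_logic V (logic_of V f) f" if "mu_dp V D f"
      using f that by (rule definable_generated_logic_of)
    note on_DL = algebraic_conditions_restrict[OF D, of f]
    show ?thesis
    proof (intro conjI)
      show "LLE V (logic_of V f)"
        by (rule LLE_of_ncl_eq)
      show "CCL V (logic_of V f)"
        by (rule CCL_of_ncl_eq)
      show "mu_dp V D f \<longrightarrow> (\<forall>T. T \<subseteq> lang V \<longrightarrow> f (Mod V T) = Mod V (ncl V (logic_of V f) T))"
        using definable_generated_logic.f_Mod_eq[OF dp] by blast
      show "mu_OR D f \<longrightarrow> OR V (logic_of V f)"
        using on_DL(1) OR_of_mu_OR by blast
      show "mu_disjOR D f \<longrightarrow> disjOR V (logic_of V f)"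
        using on_DL(2) disjOR_of_mu_disjOR by blast
      show "mu_wOR D f \<longrightarrow> wOR V (logic_of V f)"
        using on_DL(3) wOR_of_mu_wOR by blast
      show "mu_sub D f \<longrightarrow> SC V (logic_of V f)"
        using on_DL(4) SC_iff by blast
      show "mu_empty D f \<longrightarrow> CP V (logic_of V f)"
        using on_DL(5) CP_iff by blast
      show "mu_PR D f \<and> mu_dp V D f \<and> mu_sub D f \<longrightarrow> PR V (logic_of V f)"
        using on_DL(4,6) definable_generated_logic.PR_iff_mu_PR'[OF dp] mu_PR'_of_mu_PR by blast
      show "mu_PR D f \<and> mu_sub D f \<longrightarrow>
          (\<forall>T T'. T \<subseteq> lang V \<longrightarrow> T' \<subseteq> lang V \<longrightarrow> is_formula V T' \<longrightarrow>
            PR_at V (logic_of V f) T T')"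
        using on_DL(4,6) PR_at_formula mu_PR'_of_mu_PR by blast
      show "mu_PR' D f \<longrightarrow>
          (\<forall>T T'. T \<subseteq> lang V \<longrightarrow> T' \<subseteq> lang V \<longrightarrow> is_formula V T' \<longrightarrow>
            PR_at V (logic_of V f) T T')"
        using on_DL(7) PR_at_formula by blast
      show "mu_CUT D f \<longrightarrow> CUT V (logic_of V f)"
        using on_DL(8) CUT_of_mu_CUT by blast
      show "mu_CM D f \<longrightarrow> CM V (logic_of V f)"
        using on_DL(9) CM_of_mu_CM by blast
      show "mu_ResM V D f \<longrightarrow> ResM V (logic_of V f)"
        using on_DL(10) ResM_iff by blast
      show "mu_SubSup D f \<longrightarrow> SubSup V (logic_of V f)"
        using on_DL(11) SubSup_of_mu_SubSup by blast
      show "mu_CUM D f \<longrightarrow> CUM V (logic_of V f)"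
        using on_DL(12) CUM_of_mu_CUM by blast
      show "mu_RatM D f \<and> mu_dp V D f \<longrightarrow> RatM V (logic_of V f)"
        using on_DL(13) definable_generated_logic.RatM_iff_mu_RatM[OF dp] by blast
      show "mu_RatM D f \<longrightarrow>
          (\<forall>T T'. T \<subseteq> lang V \<longrightarrow> T' \<subseteq> lang V \<longrightarrow> is_formula V T \<longrightarrow>
            RatM_at V (logic_of V f) T T')"
        using on_DL(13) RatM_at_formula by blast
      show "mu_eq D f \<and> mu_dp V D f \<longrightarrow> RatMeq V (logic_of V f)"
        using on_DL(14) definable_generated_logic.RatMeq_iff_mu_eq[OF dp] by blast
      show "mu_eq D f \<longrightarrow>
          (\<forall>T T'. T \<subseteq> lang V \<longrightarrow> T' \<subseteq> lang V \<longrightarrow> is_formula V T \<longrightarrow>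
            RatMeq_at V (logic_of V f) T T')"
        using on_DL(14) RatMeq_at_formula by blast
      show "mu_eq' D f \<and> mu_dp V D f \<longrightarrow> LogEq' V (logic_of V f)"
        using on_DL(15) definable_generated_logic.LogEq'_iff_mu_eq'[OF dp] by blast
      show "mu_eq' D f \<longrightarrow>
          (\<forall>T T'. T \<subseteq> lang V \<longrightarrow> T' \<subseteq> lang V \<longrightarrow> is_formula V T \<longrightarrow>
            LogEq'_at V (logic_of V f) T T')"
        using on_DL(15) LogEq'_at_formula by blast
      show "mu_par D f \<longrightarrow> LogPar V (logic_of V f)"
        using on_DL(16) LogPar_of_mu_par by blast
      show "mu_cup D f \<and> mu_dp V D f \<longrightarrow> LogCup V (logic_of V f)"
        using on_DL(17) definable_generated_logic.LogCup_of_mu_cup[OF dp] by blast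
      show "mu_cup' D f \<and> mu_dp V D f \<longrightarrow> LogCup' V (logic_of V f)"
        using on_DL(18) definable_generated_logic.LogCup'_of_mu_cup'[OF dp] by blast
    qed
  qed
  have no_PR: ?no_PR and no_RatMeq: ?no_RatMeq and no_LogEq': ?no_LogEq'
    and no_LogCup: ?no_LogCup and no_LogCup': ?no_LogCup'
    using model_fun_on_UNIV punctured_algebraic not_mu_dp_punctured punctured_violates_rules
    by blast+
  have no_RatM: ?no_RatM
    using model_fun_on_UNIV mu_RatM_displaced not_mu_dp_displaced not_RatM_displaced by blast
  show ?thesis
    by (intro conjI[OF _ conjI[OF _ conjI[OF no_PR conjI[OF no_RatM conjI[OF no_RatMeq
            conjI[OF no_LogEq' conjI[OF no_LogCup no_LogCup']]]]]]] allI impI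
          conjI[OF unique_representing_function] from_logic to_logic)
      blast+
qed

end
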